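(* Let $P(x)=\sum_{t=0}^n a_t x^t\in\mathbb{H}[x]$ with $n\ge 1$ and $a_n\neq 0$. Then every root $x\in R(P')$ satisfies $$|x|\le \sup_{I\in\mathcal{S}}\ \min\bigl(C(P_I),\,C(P_I^\perp)\bigr),$$ i.e. $\max_{x\in R(P')}|x|\le \sup_{I\in\mathcal{S}}\min\bigl(C(P_I),C(P_I^\perp)\bigr)$.
   Context: $\mathbb{H}$ is the real algebra of quaternions $h=\alpha_0+\alpha_1 i+\alpha_2 j+\alpha_3 k$ with $i^2=j^2=k^2=ijk=-1$, with $\mathrm{Re}(h)=\alpha_0$ and absolute value $|h|=\sqrt{\alpha_0^2+\alpha_1^2+\alpha_2^2+\alpha_3^2}$, equipped with the standard Euclidean scalar product on $\mathbb{R}^4$ in the basis $1,i,j,k$. $\mathcal{S}=\{h\in\mathbb{H} : |h|=1,\ \mathrm{Re}(h)=0\}$. For $I\in\mathcal{S}$, $\mathbb{R}[I]=\{a+Ib : a,b\in\mathbb{R}\}$. A polynomial in $\mathbb{H}[x]$ is a formal expression $P(x)=\sum_{t=0}^n a_t x^t$ with $a_t\in\mathbb{H}$ (coefficients on the left), evaluated by $P(h)=\sum_t a_t h^t$. Its derivative is $P'(x)=\sum_{t=1}^n t\,a_t x^{t-1}$ and $R(P')=\{h\in\mathbb{H} : P'(h)=0\}$. For $I\in\mathcal{S}$ let $b_t$ be the orthogonal projection of $a_t$ on $\mathbb{R}[I]$ and $b_t^\perp=a_t-b_t$. Put $P_I(x)=\sum_t b_t x^t$ and $P_I^\perp(x)=\sum_t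 b_t^\perp x^t$. The function $C:\mathbb{H}[x]\to\mathbb{R}\cup\{+\infty\}$ is defined by $C(F)=+\infty$ if $F$ is constant, and, for $F(x)=\sum_{t=0}^m c_t x^t$ with $m\ge1$ and $c_m\ne0$, by $C(F)=|c_m|^{-1}\sqrt{\sum_{t=0}^m|c_t|^2}$. *)

theory Defs
  imports "HOL-Analysis.Analysis" "HOL-Computational_Algebra.Polynomial"
begin

section \<open>Quaternions\<close>

codatatype quat = Quat (qRe: real) (qIm1: real) (qIm2: real) (qIm3: real)

lemma quat_eqI [intro?]:
  "\<lbrakk>qRe x = qRe y; qIm1 x = qIm1 y; qIm2 x = qIm2 y; qIm3 x = qIm3 y\<rbrakk> \<Longrightarrow> x = y"
  by (rule quat.expand) simp

lemma quat_eq_iff: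
  "x = y \<longleftrightarrow> qRe x = qRe y \<and> qIm1 x = qIm1 y \<and> qIm2 x = qIm2 y \<and> qIm3 x = qIm3 y"
  by (auto intro: quat.expand)

instantiation quat :: ab_group_add
begin

primcorec zero_quat where
  "qRe 0 = 0" | "qIm1 0 = 0" | "qIm2 0 = 0" | "qIm3 0 = 0"

primcorec plus_quat where
  "qRe (x + y) = qRe x + qRe y"
| "qIm1 (x + y) = qIm1 x + qIm1 y"
| "qIm2 (x + y) = qIm2 x + qIm2 y"
| "qIm3 (x + y) = qIm3 x + qIm3 y"

primcorec uminus_quat where
  "qRe (- x) = - qRe x"
| "qIm1 (- x) = - qIm1 x"
| "qIm2 (- x) = - qIm2 x"
| "qIm3 (- x) = - qIm3 x"

primcorec minus_quat where
  "qRe (x - y) = qRe x - qRe y"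
| "qIm1 (x - y) = qIm1 x - qIm1 y"
| "qIm2 (x - y) = qIm2 x - qIm2 y"
| "qIm3 (x - y) = qIm3 x - qIm3 y"

instance
  by standard (simp_all add: quat_eq_iff)

end

instantiation quat :: ring_1
begin

primcorec one_quat where
  "qRe 1 = 1" | "qIm1 1 = 0" | "qIm2 1 = 0" | "qIm3 1 = 0"

primcorec times_quat where
  "qRe (x * y) = qRe x * qRe y - qIm1 x * qIm1 y - qIm2 x * qIm2 y - qIm3 x * qIm3 y"
| "qIm1 (x * y) = qRe x * qIm1 y + qIm1 x * qRe y + qIm2 x * qIm3 y - qIm3 x * qIm2 y"
| "qIm2 (x * y) = qRe x * qIm2 y - qIm1 x * qIm3 y + qIm2 x * qRe y + qIm3 x * qIm1 y"
| "qIm3 (x * y) = qRe x * qIm3 y + qIm1 x * qIm2 y - qIm2 x * qIm1 y + qIm3 x * qRe y"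

instance
  by standard (simp_all add: quat_eq_iff algebra_simps)

end

definition qi :: quat where "qi = Quat 0 1 0 0"
definition qj :: quat where "qj = Quat 0 0 1 0"
definition qk :: quat where "qk = Quat 0 0 0 1"

lemma hamilton_relations:
  "qi ^ 2 = - 1" "qj ^ 2 = - 1" "qk ^ 2 = - 1" "qi * qj * qk = - 1"
  by (simp_all add: quat_eq_iff power2_eq_square qi_def qj_def qk_def)

instantiation quat :: real_vector
begin

primcorec scaleR_quat where
  "qRe (r *\<^sub>R x) = r * qRe x"
| "qIm1 (r *\<^sub>R x) = r * qIm1 x"
| "qIm2 (r *\<^sub>R x) = r * qIm2 x"
| "qIm3 (r *\<^sub>R x) = r * qIm3 x"

instance
  by standard (simp_all add: quat_eq_iff algebra_simps)

end

instantiation quat :: real_inner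
begin

definition inner_quat :: "quat \<Rightarrow> quat \<Rightarrow> real" where
  "inner_quat x y = qRe x * qRe y + qIm1 x * qIm1 y + qIm2 x * qIm2 y + qIm3 x * qIm3 y"

definition norm_quat :: "quat \<Rightarrow> real" where
  "norm_quat x = sqrt ((qRe x)\<^sup>2 + (qIm1 x)\<^sup>2 + (qIm2 x)\<^sup>2 + (qIm3 x)\<^sup>2)"

definition sgn_quat :: "quat \<Rightarrow> quat" where
  "sgn_quat x = x /\<^sub>R norm x"

definition dist_quat :: "quat \<Rightarrow> quat \<Rightarrow> real" where
  "dist_quat x y = norm (x - y)"

definition uniformity_quat :: "(quat \<times> quat) filter" where
  "uniformity_quat = (INF e\<in>{0<..}. principal {(x, y). dist x y < e})"

definition open_quat :: "quat set \<Rightarrow> bool" where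
  "open_quat U \<longleftrightarrow> (\<forall>x\<in>U. eventually (\<lambda>(x', y). x' = x \<longrightarrow> y \<in> U) uniformity)"

instance
proof
  fix x y z :: quat and r :: real
  show "inner x y = inner y x"
    and "inner (x + y) z = inner x z + inner y z"
    and "inner (r *\<^sub>R x) y = r * inner x y"
    and "0 \<le> inner x x"
    by (simp_all add: inner_quat_def algebra_simps)
  show "inner x x = 0 \<longleftrightarrow> x = 0"
    by (auto simp: inner_quat_def quat_eq_iff add_nonneg_eq_0_iff)
  show "norm x = sqrt (inner x x)"
    by (simp add: inner_quat_def norm_quat_def power2_eq_square)
qed (simp_all add: sgn_quat_def dist_quat_def uniformity_quat_def open_quat_def)

end

lemma quat_basis_expansion:
  "x = qRe x *\<^sub>R 1 + qIm1 x *\<^sub>R qi + qIm2 x *\<^sub>R qj + qIm3 x *\<^sub>R qk"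
  by (simp add: quat_eq_iff qi_def qj_def qk_def)

instance quat :: real_algebra_1
  by standard (simp_all add: quat_eq_iff algebra_simps)

instantiation quat :: real_normed_div_algebra
begin

primcorec inverse_quat where
  "qRe (inverse x) = qRe x / (norm x)\<^sup>2"
| "qIm1 (inverse x) = - qIm1 x / (norm x)\<^sup>2"
| "qIm2 (inverse x) = - qIm2 x / (norm x)\<^sup>2"
| "qIm3 (inverse x) = - qIm3 x / (norm x)\<^sup>2"

definition divide_quat :: "quat \<Rightarrow> quat \<Rightarrow> quat" where
  "divide_quat x y = x * inverse y"

instance
proof
  fix x y :: quat
  have n2: "(norm z)\<^sup>2 = qRe z * qRe z + qIm1 z * qIm1 z + qIm2 z * qIm2 z + qIm3 z * qIm3 z"
    for z :: quat
    by (simp add: norm_quat_def power2_eq_square)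
  show "inverse x * x = 1" and "x * inverse x = 1" if "x \<noteq> 0"
  proof -
    have nz: "(norm x)\<^sup>2 \<noteq> 0" using that by simp
    show "inverse x * x = 1"
      using nz by (simp add: quat_eq_iff divide_simps) (simp add: n2)
    show "x * inverse x = 1"
      using nz by (simp add: quat_eq_iff divide_simps) (simp add: n2)
  qed
  show "x div y = x * inverse y" by (simp add: divide_quat_def)
  show "inverse (0::quat) = 0" by (simp add: quat_eq_iff)
  have "(norm (x * y))\<^sup>2 = (norm x * norm y)\<^sup>2"
    by (simp add: power_mult_distrib n2 algebra_simps)
  then show "norm (x * y) = norm x * norm y"
    by (simp add: power2_eq_iff_nonneg)
qed

end

definition imag_units :: "quat set" where
  "imag_units = {h. norm h = 1 \<and> qRe h = 0}"

definition slice :: "quat \<Rightarrow> quat set" where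
  "slice I = {of_real a + I * of_real b | a b. True}"

definition orth_proj :: "'a::real_inner set \<Rightarrow> 'a \<Rightarrow> 'a" where
  "orth_proj V a = (THE b. b \<in> V \<and> (\<forall>v\<in>V. orthogonal (a - b) v))"

section \<open>Polynomials over the quaternions\<close>

text \<open>Only the additive structure of \<^typ>\<open>quat poly\<close> is available and used: the library's
  \<^const>\<open>poly\<close> and \<^const>\<open>pderiv\<close> require commutative coefficients.\<close>

definition qpoly :: "quat poly \<Rightarrow> quat \<Rightarrow> quat" where
  "qpoly P h = (\<Sum>t\<le>degree P. coeff P t * h ^ t)"

definition qpderiv :: "quat poly \<Rightarrow> quat poly" where
  "qpderiv P = (\<Sum>t = 1..degree P. monom (of_nat t * coeff P t) (t - 1))"

definition qroots :: "quat poly \<Rightarrow> quat set" where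
  "qroots P = {h. qpoly P h = 0}"

definition proj_poly :: "quat \<Rightarrow> quat poly \<Rightarrow> quat poly" where
  "proj_poly I P = map_poly (orth_proj (slice I)) P"

definition perp_poly :: "quat \<Rightarrow> quat poly \<Rightarrow> quat poly" where
  "perp_poly I P = map_poly (\<lambda>a. a - orth_proj (slice I) a) P"

definition Cbound :: "quat poly \<Rightarrow> ereal" where
  "Cbound F = (if degree F = 0 then \<infinity>
     else ereal (inverse (norm (lead_coeff F)) * sqrt (\<Sum>t\<le>degree F. (norm (coeff F t))\<^sup>2)))"

text \<open>Well-definedness of the orthogonal projection on a slice and of the polynomials built
  from it.\<close>

lemma orth_proj_eqI:
  assumes "subspace V" "b \<in> V" "\<And>v. v \<in> V \<Longrightarrow> orthogonal (a - b) v"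
  shows "orth_proj V a = b"
  unfolding orth_proj_def
proof (rule the_equality)
  fix c assume c: "c \<in> V \<and> (\<forall>v\<in>V. orthogonal (a - c) v)"
  have "c - b \<in> V" using assms c by (simp add: subspace_diff)
  then have "inner (a - b) (c - b) = 0" "inner (a - c) (c - b) = 0"
    using assms(3) c by (auto simp: orthogonal_def)
  then have "inner (c - b) (c - b) = 0" by (simp add: inner_diff_left)
  then show "c = b" by simp
qed (use assms in auto)

lemma slice_eq_span: "slice I = span {1, I}"
proof -
  have "of_real a + I * of_real b = a *\<^sub>R 1 + b *\<^sub>R I" for a b
    by (simp add: of_real_def)
  then show ?thesis
    unfolding slice_def span_insert span_singleton
    by (auto simp: algebra_simps)
qed

lemma orth_proj_slice:
  assumes "I \<in> imag_units"
  shows "orth_proj (slice I) a = inner a 1 *\<^sub>R 1 + inner a I *\<^sub>R I"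
proof (rule orth_proj_eqI)
  have on: "inner 1 (1::quat) = 1" "inner 1 I = 0" "inner I 1 = 0" "inner I I = 1"
    using assms
    by (auto simp: imag_units_def norm_quat_def inner_quat_def power2_eq_square)
  show "subspace (slice I)" by (simp add: slice_eq_span)
  show "inner a 1 *\<^sub>R 1 + inner a I *\<^sub>R I \<in> slice I"
    by (simp add: slice_eq_span span_add span_scale span_base)
  fix v assume "v \<in> slice I"
  then obtain r s where v: "v = r *\<^sub>R 1 + s *\<^sub>R I"
    by (auto simp: slice_def of_real_def)
  show "orthogonal (a - (inner a 1 *\<^sub>R 1 + inner a I *\<^sub>R I)) v"
    by (simp add: v orthogonal_def inner_diff_left inner_add_left inner_add_right on
        algebra_simps)
qed

lemma coeff_qpderiv: "coeff (qpderiv P) n = of_nat (Suc n) * coeff P (Suc n)"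
proof -
  have "coeff (qpderiv P) n =
      (\<Sum>t = 1..degree P. if t = Suc n then of_nat t * coeff P t else 0)"
    unfolding qpderiv_def coeff_sum by (rule sum.cong) auto
  then show ?thesis by (simp add: coeff_eq_0 del: of_nat_Suc)
qed

lemma coeff_proj_poly:
  "I \<in> imag_units \<Longrightarrow> coeff (proj_poly I P) n = orth_proj (slice I) (coeff P n)"
  by (simp add: proj_poly_def coeff_map_poly orth_proj_slice)

lemma coeff_perp_poly:
  "I \<in> imag_units \<Longrightarrow> coeff (perp_poly I P) n = coeff P n - orth_proj (slice I) (coeff P n)"
  by (simp add: perp_poly_def coeff_map_poly orth_proj_slice)

end

theory Submission
  imports Defs
begin

text \<open>
  Choose \<open>I\<close> such that the critical point \<open>x\<close> lies in \<open>\<real>[I]\<close>. The orthogonal projection onto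
  \<open>\<real>[I]\<close> commutes with right multiplication by \<open>x\<close>, so \<open>P'(x) = 0\<close> splits into \<open>P\<^sub>I'(x) = 0\<close> and
  \<open>P\<^sub>I\<^sup>\<bottom>'(x) = 0\<close>. Gauss--Lucas is not needed: by Cauchy--Schwarz the roots of \<open>F'\<close> are bounded by
  \<open>C(F')\<close>, and \<open>C(F') \<le> C(F)\<close> since \<open>F'\<close> has the coefficients of \<open>F\<close> multiplied by \<open>t \<le> m = deg F\<close>,
  the leading one by \<open>m\<close> itself.
\<close>

text \<open>For \<open>norm z \<le> 1\<close> the leading summand alone dominates the left side.
  Otherwise the leading term is isolated and Cauchy-Schwarz leaves a geometric sum in the squared
  norm of \<open>z\<close>.\<close>

lemma norm_root_le:
  fixes c :: "nat \<Rightarrow> 'a::real_normed_div_algebra"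
  assumes "(\<Sum>t\<le>m. c t * z ^ t) = 0"
  shows "(norm (c m) * norm z)\<^sup>2 \<le> (\<Sum>t\<le>m. (norm (c t))\<^sup>2)"
proof -
  define r where "r = norm z"
  define A where "A = (norm (c m))\<^sup>2"
  define S where "S = (\<Sum>t<m. (norm (c t))\<^sup>2)"
  have S0: "S \<ge> 0" and A0: "A \<ge> 0" and r0: "r \<ge> 0"
    by (auto simp: S_def A_def r_def sum_nonneg)
  have total: "(\<Sum>t\<le>m. (norm (c t))\<^sup>2) = S + A"
    by (simp add: S_def A_def lessThan_Suc_atMost[symmetric])
  have "A * r\<^sup>2 \<le> S + A"
  proof (cases "r \<le> 1")
    case True
    then have "r\<^sup>2 \<le> 1" using r0 by (simp add: power_le_one)
    then have "A * r\<^sup>2 \<le> A * 1" using A0 by (rule mult_left_mono)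
    then show ?thesis using S0 by simp
  next
    case False
    then have r1: "r\<^sup>2 > 1" by (simp add: one_less_power)
    have "c m * z ^ m = - (\<Sum>t<m. c t * z ^ t)"
      using assms by (simp add: lessThan_Suc_atMost[symmetric] add_eq_0_iff)
    then have "norm (c m) * r ^ m = norm (\<Sum>t<m. c t * z ^ t)"
      by (metis norm_minus_cancel norm_mult norm_power r_def)
    also have "\<dots> \<le> (\<Sum>t<m. norm (c t) * r ^ t)"
      by (rule order_trans[OF norm_sum]) (simp add: norm_mult norm_power r_def)
    finally have "(norm (c m) * r ^ m)\<^sup>2 \<le> (\<Sum>t<m. norm (c t) * r ^ t)\<^sup>2"
      by (rule power_mono) (simp add: r0)
    also have "\<dots> \<le> S * (\<Sum>t<m. (r ^ t)\<^sup>2)"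
      unfolding S_def by (rule Cauchy_Schwarz_ineq_sum)
    also have "(\<Sum>t<m. (r ^ t)\<^sup>2) = (\<Sum>t<m. (r\<^sup>2) ^ t)"
      by (simp add: power_mult[symmetric] mult.commute)
    finally have "A * (r\<^sup>2) ^ m \<le> S * (\<Sum>t<m. (r\<^sup>2) ^ t)"
      by (simp add: A_def power_mult_distrib power_mult[symmetric] mult.commute)
    \<comment> \<open>The positive factor \<open>r\<^sup>2 - 1\<close> telescopes the geometric sum
      to \<open>(r\<^sup>2) ^ m - 1\<close>, so that \<open>(r\<^sup>2) ^ m\<close> can be
      cancelled.\<close>
    then have "A * (r\<^sup>2) ^ m * (r\<^sup>2 - 1) \<le> S * (\<Sum>t<m. (r\<^sup>2) ^ t) * (r\<^sup>2 - 1)"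
      using r1 by (intro mult_right_mono) auto
    also have "\<dots> = S * ((r\<^sup>2) ^ m - 1)"
      using power_diff_1_eq[of "r\<^sup>2" m] by (simp add: mult_ac)
    also have "\<dots> \<le> S * (r\<^sup>2) ^ m" using S0 by (intro mult_left_mono) auto
    finally have "(A * (r\<^sup>2 - 1)) * (r\<^sup>2) ^ m \<le> S * (r\<^sup>2) ^ m" by (simp add: mult_ac)
    moreover have "(r\<^sup>2) ^ m > 0" using False by simp
    ultimately have "A * (r\<^sup>2 - 1) \<le> S" by (simp only: mult_le_cancel_right_pos)
    then show ?thesis by (simp add: algebra_simps)
  qed
  then show ?thesis by (simp add: total A_def r_def power_mult_distrib)
qed

text \<open>Any \<open>n\<close> above the degree is allowed, so that \<open>P\<close> and its two
  components, whose degrees may drop, can be summed over one common range.\<close>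

lemma qpoly_qpderiv:
  assumes "degree F \<le> n"
  shows "qpoly (qpderiv F) x = (\<Sum>t<n. of_nat (Suc t) * coeff F (Suc t) * x ^ t)"
proof -
  define D where "D = max n (Suc (degree (qpderiv F)))"
  have "qpoly (qpderiv F) x = (\<Sum>t<D. coeff (qpderiv F) t * x ^ t)"
    unfolding qpoly_def
    by (rule sum.mono_neutral_left) (auto simp: D_def coeff_eq_0 not_le)
  also have "\<dots> = (\<Sum>t<n. coeff (qpderiv F) t * x ^ t)"
    by (rule sum.mono_neutral_right)
       (use assms in \<open>auto simp: D_def coeff_qpderiv coeff_eq_0 not_less\<close>)
  finally show ?thesis by (simp add: coeff_qpderiv)
qed

lemma norm_critical_point_le_Cbound:
  assumes "qpoly (qpderiv F) x = 0"
  shows "ereal (norm x) \<le> Cbound F"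
proof (cases "degree F")
  \<comment> \<open>Constant components of \<open>P\<close> land here, where \<open>Cbound\<close>
    is infinite.\<close>
  case 0
  then show ?thesis by (simp add: Cbound_def)
next
  case (Suc k)
  define m where "m = real (Suc k)"
  define c where "c t = of_nat (Suc t) * coeff F (Suc t)" for t
  define S where "S = (\<Sum>t\<le>degree F. (norm (coeff F t))\<^sup>2)"
  define l where "l = norm (lead_coeff F)"
  have norm_c: "norm (c t) = real (Suc t) * norm (coeff F (Suc t))" for t
    unfolding c_def norm_mult norm_of_nat ..
  have "F \<noteq> 0" using Suc by auto
  then have l: "l > 0" by (simp add: l_def)
  have m: "m > 0" by (simp add: m_def)
  have "(\<Sum>t\<le>k. c t * x ^ t) = 0"
    using assms qpoly_qpderiv[of F "Suc k" x] Suc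
    by (simp add: c_def lessThan_Suc_atMost del: of_nat_Suc sum.lessThan_Suc)
  from norm_root_le[OF this] have "(m * (l * norm x))\<^sup>2 \<le> (\<Sum>t\<le>k. (norm (c t))\<^sup>2)"
    by (simp add: norm_c m_def l_def Suc mult.assoc)
  \<comment> \<open>Every factor \<open>Suc t\<close> is at most \<open>m\<close>, the factor on the
    leading coefficient, so \<open>m\<^sup>2\<close> cancels at the end.\<close>
  also have "\<dots> \<le> (\<Sum>t\<le>k. m\<^sup>2 * (norm (coeff F (Suc t)))\<^sup>2)"
    unfolding norm_c power_mult_distrib
    by (intro sum_mono mult_right_mono power_mono) (auto simp: m_def)
  also have "\<dots> = m\<^sup>2 * (\<Sum>t\<le>k. (norm (coeff F (Suc t)))\<^sup>2)"
    by (simp add: sum_distrib_left)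
  \<comment> \<open>\<open>S\<close> also contains the constant coefficient, which the derivative
    loses.\<close>
  also have "\<dots> \<le> m\<^sup>2 * S"
    unfolding S_def Suc sum.atMost_Suc_shift by (intro mult_left_mono) auto
  finally have "(l * norm x)\<^sup>2 \<le> S"
    using m by (simp add: power_mult_distrib)
  then have "l * norm x \<le> sqrt S" by (rule real_le_rsqrt)
  then have "norm x \<le> inverse l * sqrt S"
    using l by (simp add: field_simps)
  then show ?thesis by (simp add: Cbound_def S_def l_def Suc)
qed

lemma ex_slice: "\<exists>I\<in>imag_units. x \<in> slice I"
proof -
  define v where "v = Quat 0 (qIm1 x) (qIm2 x) (qIm3 x)"
  have x: "x = of_real (qRe x) + v"
    by (simp add: v_def quat_eq_iff of_real_def)
  show ?thesis
  proof (cases "v = 0")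
    \<comment> \<open>A real \<open>x\<close> lies in every slice; \<open>qi\<close> is an arbitrary
      choice.\<close>
    case True
    have "qi \<in> imag_units" by (simp add: imag_units_def qi_def norm_quat_def)
    moreover have "x = of_real (qRe x) + qi * of_real 0" using x True by simp
    ultimately show ?thesis unfolding slice_def by blast
  next
    case False
    have "v /\<^sub>R norm v \<in> imag_units"
      using False by (simp add: imag_units_def) (simp add: v_def)
    moreover have "x = of_real (qRe x) + (v /\<^sub>R norm v) * of_real (norm v)"
      using x False by (simp add: of_real_def)
    ultimately show ?thesis unfolding slice_def by blast
  qed
qed

lemma linear_orth_proj_slice:
  assumes "I \<in> imag_units"
  shows "linear (orth_proj (slice I))"
  by (rule linearI) (simp_all add: orth_proj_slice[OF assms] inner_add_left algebra_simps)

text \<open>Since \<open>I * I = - 1\<close>, right multiplication by \<open>I\<close> rotates the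
  coordinates along \<open>1\<close> and \<open>I\<close> into each other; linearity extends this to
  \<open>p + q I\<close>.\<close>

lemma orth_proj_slice_mult_right:
  assumes I: "I \<in> imag_units" and x: "x \<in> slice I"
  shows "orth_proj (slice I) (a * x) = orth_proj (slice I) a * x"
proof -
  obtain p q where xpq: "x = p *\<^sub>R 1 + q *\<^sub>R I"
    using x by (auto simp: slice_def of_real_def)
  have re: "qRe I = 0" and nrm: "norm I = 1" using I by (auto simp: imag_units_def)
  have sq: "qIm1 I * qIm1 I + qIm2 I * qIm2 I + qIm3 I * qIm3 I = 1"
    using nrm re by (simp add: norm_quat_def power2_eq_square)
  have II: "I * I = - 1"
    using sq by (simp add: quat_eq_iff re)
  have aI1: "inner (a * I) 1 = - inner a I"
    by (simp add: inner_quat_def re)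
  \<comment> \<open>The other terms form the triple product of Im a, \<open>I\<close> and
    \<open>I\<close>, which vanishes.\<close>
  have "inner (a * I) I = qRe a * (qIm1 I * qIm1 I + qIm2 I * qIm2 I + qIm3 I * qIm3 I)"
    by (simp add: inner_quat_def re algebra_simps)
  then have aII: "inner (a * I) I = inner a 1"
    by (simp add: sq) (simp add: inner_quat_def)
  have "orth_proj (slice I) (a * I) = orth_proj (slice I) a * I"
    by (simp add: orth_proj_slice[OF I] aI1 aII II algebra_simps)
  then show ?thesis
    using linear_orth_proj_slice[OF I]
    by (simp add: xpq distrib_left linear_add linear_scale)
qed

lemma orth_proj_slice_mult_power:
  assumes "I \<in> imag_units" and "x \<in> slice I"
  shows "orth_proj (slice I) (a * x ^ n) = orth_proj (slice I) a * x ^ n"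
  \<comment> \<open>The extra factor of \<open>x ^ Suc n\<close> stands on the left and is absorbed
    into \<open>a\<close>, hence the generalization.\<close>
  by (induction n arbitrary: a)
     (simp_all add: mult.assoc[symmetric] orth_proj_slice_mult_right[OF assms])

text \<open>With coefficients on the left, the projection passes through the powers of
  \<open>x\<close> on the right and, by linearity, through the sum and the integer factors.\<close>

lemma qpoly_qpderiv_proj_poly:
  assumes I: "I \<in> imag_units" and x: "x \<in> slice I"
  shows "qpoly (qpderiv (proj_poly I P)) x = orth_proj (slice I) (qpoly (qpderiv P) x)"
proof -
  note lin = linear_orth_proj_slice[OF I]
  have of_nat_scale: "of_nat k * a = real k *\<^sub>R a" for k and a :: quat
    by (metis of_real_of_nat_eq scaleR_conv_of_real)
  have "degree (proj_poly I P) \<le> degree P"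
    by (rule degree_le) (simp add: coeff_proj_poly[OF I] coeff_eq_0 linear_0[OF lin])
  then show ?thesis
    by (simp add: qpoly_qpderiv[where n = "degree P"] linear_sum[OF lin] of_nat_scale
        linear_scale[OF lin] coeff_proj_poly[OF I] orth_proj_slice_mult_power[OF I x]
        del: of_nat_Suc)
qed

lemma qpoly_qpderiv_perp_poly:
  assumes I: "I \<in> imag_units"
  shows "qpoly (qpderiv (perp_poly I P)) x =
    qpoly (qpderiv P) x - qpoly (qpderiv (proj_poly I P)) x"
proof -
  have "degree (proj_poly I P) \<le> degree P" "degree (perp_poly I P) \<le> degree P"
    by (rule degree_le; simp add: coeff_proj_poly[OF I] coeff_perp_poly[OF I] coeff_eq_0
        linear_0[OF linear_orth_proj_slice[OF I]])+
  then show ?thesis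
    by (simp add: qpoly_qpderiv[where n = "degree P"] coeff_proj_poly[OF I]
        coeff_perp_poly[OF I] sum_subtractf[symmetric] algebra_simps)
qed

theorem lemma5p3:
  fixes P :: "quat poly"
  assumes "degree P \<ge> 1"
  shows "\<forall>x \<in> qroots (qpderiv P).
    ereal (norm x) \<le> (SUP I\<in>imag_units. min (Cbound (proj_poly I P)) (Cbound (perp_poly I P)))"
proof
  fix x assume "x \<in> qroots (qpderiv P)"
  then have root: "qpoly (qpderiv P) x = 0" by (simp add: qroots_def)
  \<comment> \<open>The slice depends on \<open>x\<close>; the supremum makes the bound
    uniform.\<close>
  obtain I where I: "I \<in> imag_units" and x: "x \<in> slice I" using ex_slice by blast
  have proj: "qpoly (qpderiv (proj_poly I P)) x = 0"
    using linear_0[OF linear_orth_proj_slice[OF I]]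
    by (simp add: qpoly_qpderiv_proj_poly[OF I x] root)
  have perp: "qpoly (qpderiv (perp_poly I P)) x = 0"
    by (simp add: qpoly_qpderiv_perp_poly[OF I] root proj)
  show "ereal (norm x) \<le>
      (SUP I\<in>imag_units. min (Cbound (proj_poly I P)) (Cbound (perp_poly I P)))"
    by (rule SUP_upper2[OF I]) (simp add: norm_critical_point_le_Cbound proj perp)
qed

end
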